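(* If $\mathcal{G}$ is a tree such that $\mathrm{val}(l)\le 3$ for each edge $l$ of $\mathcal{G}$, then $\mathcal{G}$ is positive.
   Context: Graphs are finite, simple, and have at least one edge. A tree is a connected graph with no cycles. Two distinct edges of a graph are adjacent if they share a vertex; for an edge $l$, $\mathrm{val}(l)$ denotes the number of edges adjacent to $l$ (the valency of $l$ in the line graph $L(\mathcal{G})$). Here $L(\mathcal{G})$ is the graph whose vertices are the edges $l_1,\dots,l_q$ of $\mathcal{G}$, two being joined iff they are adjacent, and $\mathrm{Adj}\,L(\mathcal{G})$ is its $q\times q$ adjacency matrix. The matrix $3I+\mathrm{Adj}\,L(\mathcal{G})$ is positive definite, and $\mathcal{G}$ is called positive if all entries of the vector $(3I+\mathrm{Adj}\,L(\mathcal{G}))^{-1}(1,\dots,1)^t$ are positive. *)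

theory Defs
  imports "Jordan_Normal_Form.Gauss_Jordan_Elimination"
begin

text \<open>A graph is given by its vertex set \<open>V\<close> and its set \<open>E\<close> of edges, an edge being the
  two-element set of its end points.\<close>

definition simple_graph :: "'a set \<Rightarrow> 'a set set \<Rightarrow> bool" where
  "simple_graph V E \<longleftrightarrow> finite V \<and> (\<forall>e\<in>E. e \<subseteq> V \<and> card e = 2)"

definition connected_graph :: "'a set \<Rightarrow> 'a set set \<Rightarrow> bool" where
  "connected_graph V E \<longleftrightarrow> (\<forall>u\<in>V. \<forall>v\<in>V. (u, v) \<in> {(x, y). {x, y} \<in> E}\<^sup>*)"

text \<open>A cycle is listed by its pairwise distinct vertices; the first one is not repeated at
  the end.\<close>

definition graph_cycle :: "'a set set \<Rightarrow> 'a list \<Rightarrow> bool" where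
  "graph_cycle E p \<longleftrightarrow> 3 \<le> length p \<and> distinct p \<and>
     (\<forall>i<length p. {p ! i, p ! (Suc i mod length p)} \<in> E)"

definition tree_graph :: "'a set \<Rightarrow> 'a set set \<Rightarrow> bool" where
  "tree_graph V E \<longleftrightarrow> simple_graph V E \<and> connected_graph V E \<and> (\<nexists>p. graph_cycle E p)"

definition adjacent_edges :: "'a set \<Rightarrow> 'a set \<Rightarrow> bool" where
  "adjacent_edges l m \<longleftrightarrow> l \<noteq> m \<and> l \<inter> m \<noteq> {}"

definition edge_val :: "'a set set \<Rightarrow> 'a set \<Rightarrow> nat" where
  "edge_val E l = card {m \<in> E. adjacent_edges l m}"

text \<open>The line graph has vertex set \<open>E\<close>; these are its edges.\<close>

definition line_graph_edges :: "'a set set \<Rightarrow> 'a set set set" where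
  "line_graph_edges E = {{l, m} | l m. l \<in> E \<and> m \<in> E \<and> adjacent_edges l m}"

text \<open>Adjacency matrix of a graph with edge set \<open>E\<close>, with respect to the enumeration \<open>vs\<close> of
  its vertices. Singletons are not edges, so the diagonal vanishes.\<close>

definition adjacency_mat :: "'b set set \<Rightarrow> 'b list \<Rightarrow> real mat" where
  "adjacency_mat E vs =
     mat (length vs) (length vs) (\<lambda>(i, j). if {vs ! i, vs ! j} \<in> E then 1 else 0)"

text \<open>The edges may be numbered \<open>l\<^sub>1, \<dots>, l\<^sub>q\<close> in any order; positivity does not depend on the
  order, and we ask for it for every numbering. At least one numbering exists whenever \<open>E\<close> is
  finite. Existence of the inverse matrix is part of the definition.\<close>

definition positive_graph :: "'a set set \<Rightarrow> bool" where
  "positive_graph E \<longleftrightarrow>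
     (\<forall>ls. distinct ls \<and> set ls = E \<longrightarrow>
        (\<exists>B. mat_inverse (3 \<cdot>\<^sub>m 1\<^sub>m (length ls) + adjacency_mat (line_graph_edges E) ls) = Some B \<and>
             (\<forall>i<length ls. (B *\<^sub>v vec (length ls) (\<lambda>_. 1)) $ i > 0)))"

end

theory Submission
  imports Defs "Jordan_Normal_Form.Determinant"
begin

text \<open>
  The equation \<open>(3I + Adj L(G)) x = (1, \<dots>, 1)\<^sup>t\<close> says that \<open>3 x\<^sub>l\<close> plus the sum of \<open>x\<close> over the
  edges adjacent to \<open>l\<close> equals \<open>1\<close>, for every edge \<open>l\<close>.  As there are at most three adjacent
  edges, the row of \<open>l\<close> is weakly diagonally dominant, and a maximum principle comes within a
  hair of the claim.  Let \<open>M\<close> and \<open>m\<close> be the largest and the smallest coordinate and suppose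
  \<open>m \<le> 0\<close>.  The equation at a maximal edge gives \<open>3M \<le> 1 - 3m\<close>, the one at a minimal edge
  gives \<open>3m \<ge> 1 - 3M\<close>.  Hence \<open>M + m = 1/3\<close>, and equality at the minimal edge forces it to have
  exactly three neighbours, all with value \<open>M\<close>.

  This extremal configuration does not fit into a line graph: by the pigeonhole principle two of
  the three neighbours meet the minimal edge in the same end point, so they are adjacent to each
  other (\<open>adjacent_pair_of_neighbours\<close>).  The equation at one of these two neighbours then gives
  \<open>1 \<ge> 4M + 2m = 2M + 2/3 \<ge> 4/3\<close>, because \<open>M = 1/3 - m \<ge> 1/3\<close>.

  The same argument with right-hand side \<open>0\<close> shows that the kernel of the matrix is trivial, which
  provides the inverse.  Both uses are covered by one statement with a right-hand side \<open>c \<ge> 0\<close>,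
  \<open>nonpositive_coordinate_imp_trivial\<close>: a solution with a nonpositive coordinate exists only for
  \<open>c = 0\<close>, and it vanishes.
\<close>

text \<open>The maximum principle, for an arbitrary neighbourhood assignment \<open>N\<close>.  The assumption
  \<open>triangle\<close> excludes the case in which both extremal estimates are sharp with \<open>x \<noteq> 0\<close>; it
  fails, for instance, for the three-dimensional cube, where values \<open>1\<close> and \<open>-1\<close> according to
  parity solve the homogeneous system.\<close>

lemma nonpositive_coordinate_imp_trivial:
  fixes x :: "'b \<Rightarrow> real" and N :: "'b \<Rightarrow> 'b set" and c :: real
  assumes fin: "finite S"
    and N_subset: "\<And>i. i \<in> S \<Longrightarrow> N i \<subseteq> S"
    and degree: "\<And>i. i \<in> S \<Longrightarrow> card (N i) \<le> 3"
    and triangle: "\<And>i. i \<in> S \<Longrightarrow> card (N i) = 3 \<Longrightarrow> \<exists>a\<in>N i. \<exists>b\<in>N i. b \<in> N a"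
    and eq: "\<And>i. i \<in> S \<Longrightarrow> 3 * x i + (\<Sum>j\<in>N i. x j) = c"
    and c: "0 \<le> c"
    and k: "k \<in> S" "x k \<le> 0"
  shows "c = 0 \<and> (\<forall>i\<in>S. x i = 0)"
proof -
  have fin_N: "finite (N i)" if "i \<in> S" for i
    using N_subset[OF that] fin by (rule finite_subset)
  have "finite (x ` S)" "x ` S \<noteq> {}" using fin k by auto
  then have "Min (x ` S) \<in> x ` S" "Max (x ` S) \<in> x ` S" by simp_all
  then obtain l p where l: "l \<in> S" "x l = Min (x ` S)" and p: "p \<in> S" "x p = Max (x ` S)"
    by (metis imageE)
  have bounds: "x l \<le> x i" "x i \<le> x p" if "i \<in> S" for i
    using that fin l(2) p(2) by auto
  have l_nonpos: "x l \<le> 0" using bounds(1)[OF k(1)] k(2) by linarith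
  have sum_ge: "real n * x l \<le> (\<Sum>j\<in>A. x j)" if "A \<subseteq> S" "card A \<le> n" for A n
  proof -
    have "real n * x l \<le> real (card A) * x l"
      using that(2) l_nonpos by (intro mult_right_mono_neg) auto
    also have "\<dots> \<le> (\<Sum>j\<in>A. x j)"
      using that(1) bounds(1) by (intro sum_bounded_below) auto
    finally show ?thesis .
  qed
  have p_nonneg: "0 \<le> x p"
  proof (rule ccontr)
    assume "\<not> 0 \<le> x p"
    then have "(\<Sum>j\<in>N p. x j) \<le> 0"
      using N_subset[OF p(1)] bounds(2) by (intro sum_nonpos) force
    with eq[OF p(1)] c \<open>\<not> 0 \<le> x p\<close> show False by linarith
  qed
  have upper: "3 * x p + 3 * x l \<le> c"
    using sum_ge[OF N_subset[OF p(1)] degree[OF p(1)]] eq[OF p(1)] by simp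
  have sum_le_card: "(\<Sum>j\<in>N l. x j) \<le> real (card (N l)) * x p"
    using N_subset[OF l(1)] bounds(2) by (intro sum_bounded_above) auto
  have "real (card (N l)) * x p \<le> 3 * x p"
    using degree[OF l(1)] p_nonneg by (intro mult_right_mono) auto
  with sum_le_card upper eq[OF l(1)]
  have sharp: "3 * x p + 3 * x l = c" and sum_l: "(\<Sum>j\<in>N l. x j) = 3 * x p"
    and card_l: "real (card (N l)) * x p = 3 * x p"
    by linarith+
  have "x p = 0"
  proof (rule ccontr)
    assume "x p \<noteq> 0"
    with card_l have card3: "card (N l) = 3" by simp
    have "(\<Sum>j\<in>N l. x p - x j) = 0"
      using sum_l card3 by (simp add: sum_subtractf)
    moreover have "0 \<le> x p - x j" if "j \<in> N l" for j
      using that N_subset[OF l(1)] bounds(2)[of j] by auto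
    ultimately have "\<forall>j\<in>N l. x p - x j = 0"
      using sum_nonneg_eq_0_iff[OF fin_N[OF l(1)], of "\<lambda>j. x p - x j"] by blast
    then have neighbours_max: "x j = x p" if "j \<in> N l" for j
      using that by simp
    obtain a b where a: "a \<in> N l" and b: "b \<in> N l" and ab: "b \<in> N a"
      using triangle[OF l(1) card3] by blast
    have aS: "a \<in> S" using a N_subset[OF l(1)] by blast
    have "card (N a - {b}) \<le> 2"
      using degree[OF aS] ab fin_N[OF aS] by simp
    then have "2 * x l \<le> (\<Sum>j\<in>N a - {b}. x j)"
      using sum_ge[of "N a - {b}" 2] N_subset[OF aS] by auto
    moreover have "(\<Sum>j\<in>N a. x j) = x b + (\<Sum>j\<in>N a - {b}. x j)"
      using ab fin_N[OF aS] by (rule sum.remove[rotated])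
    ultimately have "4 * x p + 2 * x l \<le> c"
      using eq[OF aS] neighbours_max[OF a] neighbours_max[OF b] by linarith
    with sharp l_nonpos c p_nonneg \<open>x p \<noteq> 0\<close> show False by linarith
  qed
  with sharp l_nonpos c have "c = 0" "x l = 0" by linarith+
  with \<open>x p = 0\<close> bounds show ?thesis by force
qed

text \<open>The pigeonhole step: each neighbour of \<open>l\<close> contains one of the two end points of \<open>l\<close>, so
  among three neighbours two share an end point with each other.\<close>

lemma adjacent_pair_of_neighbours:
  assumes "card l = 2" and "edge_val E l = 3"
  obtains a b where "a \<in> E" "b \<in> E" "adjacent_edges l a" "adjacent_edges l b" "adjacent_edges a b"
proof -
  obtain u w where l: "l = {u, w}" using \<open>card l = 2\<close> by (meson card_2_iff)
  define A where "A v = {m \<in> E. adjacent_edges l m \<and> v \<in> m}" for v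
  have card_neighbours: "card {m \<in> E. adjacent_edges l m} = 3"
    using \<open>edge_val E l = 3\<close> by (simp add: edge_val_def)
  have split: "{m \<in> E. adjacent_edges l m} = A u \<union> A w"
    by (auto simp: A_def adjacent_edges_def l)
  have fin: "finite (A u \<union> A w)"
    using card_neighbours split by (metis card.infinite zero_neq_numeral)
  have "card (A u \<union> A w) \<le> card (A u) + card (A w)" by (rule card_Un_le)
  then have "\<not> card (A u) \<le> Suc 0 \<or> \<not> card (A w) \<le> Suc 0"
    using card_neighbours[unfolded split] by linarith
  then obtain v where "\<not> card (A v) \<le> Suc 0" and "finite (A v)"
    using fin by blast
  then obtain a b where "a \<in> A v" "b \<in> A v" "a \<noteq> b"
    using card_le_Suc0_iff_eq by blast
  then show thesis by (intro that[of a b]) (auto simp: A_def adjacent_edges_def)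
qed

abbreviation adjacent_indices :: "'a set list \<Rightarrow> nat \<Rightarrow> nat set" where
  "adjacent_indices ls i \<equiv> {j. j < length ls \<and> adjacent_edges (ls ! i) (ls ! j)}"

abbreviation shifted_line_mat :: "'a set list \<Rightarrow> real mat" where
  "shifted_line_mat ls \<equiv>
     3 \<cdot>\<^sub>m 1\<^sub>m (length ls) + adjacency_mat (line_graph_edges (set ls)) ls"

lemma shifted_line_mat_carrier:
  "shifted_line_mat ls \<in> carrier_mat (length ls) (length ls)"
  by (simp add: adjacency_mat_def)

lemma line_graph_edges_iff:
  assumes "l \<in> E" "m \<in> E"
  shows "{l, m} \<in> line_graph_edges E \<longleftrightarrow> adjacent_edges l m"
  using assms by (auto simp: line_graph_edges_def adjacent_edges_def doubleton_eq_iff)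

lemma shifted_line_mat_mult_index:
  assumes v: "v \<in> carrier_vec (length ls)" and i: "i < length ls"
  shows "(shifted_line_mat ls *\<^sub>v v) $ i = 3 * v $ i + (\<Sum>j\<in>adjacent_indices ls i. v $ j)"
proof -
  let ?q = "length ls"
  have "(shifted_line_mat ls *\<^sub>v v) $ i
      = (\<Sum>j<?q. ((if i = j then 3 else 0)
          + (if adjacent_edges (ls ! i) (ls ! j) then 1 else 0)) * v $ j)"
    using v i
    by (auto simp: scalar_prod_def adjacency_mat_def line_graph_edges_iff atLeast0LessThan
        intro!: sum.cong)
  also have "\<dots> = (\<Sum>j<?q. if i = j then 3 * v $ j else 0)
      + (\<Sum>j<?q. if adjacent_edges (ls ! i) (ls ! j) then v $ j else 0)"
    by (subst sum.distrib[symmetric], rule sum.cong) auto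
  also have "(\<Sum>j<?q. if i = j then 3 * v $ j else 0) = 3 * v $ i"
    using i by simp
  also have "(\<Sum>j<?q. if adjacent_edges (ls ! i) (ls ! j) then v $ j else 0)
      = (\<Sum>j\<in>adjacent_indices ls i. v $ j)"
    by (simp add: sum.If_cases Int_def)
  finally show ?thesis .
qed

lemma card_adjacent_indices:
  assumes "distinct ls"
  shows "card (adjacent_indices ls i) = edge_val (set ls) (ls ! i)"
proof -
  have "inj_on ((!) ls) (adjacent_indices ls i)"
    using assms by (auto simp: inj_on_def nth_eq_iff_index_eq)
  moreover have "(!) ls ` adjacent_indices ls i = {m \<in> set ls. adjacent_edges (ls ! i) m}"
    by (auto simp: in_set_conv_nth)
  ultimately show ?thesis
    unfolding edge_val_def using card_image by fastforce
qed

text \<open>The maximum principle transferred to edge numberings, in the form used for both the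
  kernel (\<open>c = 0\<close>) and the solution of the system (\<open>c = 1\<close>).\<close>

lemma shifted_line_mat_nonpositive_coordinate:
  fixes ls :: "'a set list"
  assumes ls: "distinct ls"
    and card2: "\<And>l. l \<in> set ls \<Longrightarrow> card l = 2"
    and val: "\<And>l. l \<in> set ls \<Longrightarrow> edge_val (set ls) l \<le> 3"
    and v: "v \<in> carrier_vec (length ls)"
    and eq: "shifted_line_mat ls *\<^sub>v v = vec (length ls) (\<lambda>_. c)"
    and c: "0 \<le> c"
    and k: "k < length ls" "v $ k \<le> 0"
  shows "c = 0 \<and> (\<forall>i<length ls. v $ i = 0)"
proof -
  have "c = 0 \<and> (\<forall>i\<in>{..<length ls}. v $ i = 0)"
  proof (rule nonpositive_coordinate_imp_trivial[where N = "adjacent_indices ls" and k = k])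
    fix i assume i: "i \<in> {..<length ls}"
    then have il: "ls ! i \<in> set ls" by simp
    show "card (adjacent_indices ls i) \<le> 3"
      using val[OF il] card_adjacent_indices[OF ls] by simp
    show "3 * v $ i + (\<Sum>j\<in>adjacent_indices ls i. v $ j) = c"
      using shifted_line_mat_mult_index[OF v, of i] i by (simp add: eq)
    assume "card (adjacent_indices ls i) = 3"
    then have "edge_val (set ls) (ls ! i) = 3"
      using card_adjacent_indices[OF ls] by simp
    then obtain a b where ab: "a \<in> set ls" "b \<in> set ls"
        "adjacent_edges (ls ! i) a" "adjacent_edges (ls ! i) b" "adjacent_edges a b"
      using adjacent_pair_of_neighbours[OF card2[OF il]] by metis
    moreover obtain m n where "m < length ls" "a = ls ! m" "n < length ls" "b = ls ! n"
      using ab(1,2) by (auto simp: in_set_conv_nth)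
    ultimately have "m \<in> adjacent_indices ls i" "n \<in> adjacent_indices ls i"
        "n \<in> adjacent_indices ls m"
      by simp_all
    then show "\<exists>a\<in>adjacent_indices ls i. \<exists>b\<in>adjacent_indices ls i. b \<in> adjacent_indices ls a"
      by blast
  qed (use c k in auto)
  then show ?thesis by simp
qed

lemma shifted_line_mat_kernel_trivial:
  assumes ls: "distinct ls"
    and card2: "\<And>l. l \<in> set ls \<Longrightarrow> card l = 2"
    and val: "\<And>l. l \<in> set ls \<Longrightarrow> edge_val (set ls) l \<le> 3"
    and v: "v \<in> carrier_vec (length ls)"
    and ker: "shifted_line_mat ls *\<^sub>v v = 0\<^sub>v (length ls)"
  shows "v = 0\<^sub>v (length ls)"
proof (cases "\<exists>k<length ls. v $ k \<le> 0")
  case True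
  moreover have "shifted_line_mat ls *\<^sub>v v = vec (length ls) (\<lambda>_. 0)"
    using ker by (simp add: zero_vec_def)
  ultimately have "\<forall>i<length ls. v $ i = 0"
    using shifted_line_mat_nonpositive_coordinate[OF ls card2 val v, of 0] by blast
  then show ?thesis using v by (intro eq_vecI) auto
next
  \<comment> \<open>An all-positive vector cannot lie in the kernel of a nonnegative matrix with positive
      diagonal, so here there are no coordinates at all.\<close>
  case False
  have "\<not> i < length ls" for i
  proof
    assume i: "i < length ls"
    have "0 \<le> (\<Sum>j\<in>adjacent_indices ls i. v $ j)"
      using False by (intro sum_nonneg) force
    moreover have "0 < v $ i" using False i by force
    moreover have "3 * v $ i + (\<Sum>j\<in>adjacent_indices ls i. v $ j) = 0"
      using shifted_line_mat_mult_index[OF v i] i by (simp add: ker)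
    ultimately show False by linarith
  qed
  then show ?thesis using v by (intro eq_vecI) auto
qed

theorem theorem5p8:
  fixes V :: "'a set" and E :: "'a set set"
  assumes "tree_graph V E"
    and "E \<noteq> {}"
    and "\<And>l. l \<in> E \<Longrightarrow> edge_val E l \<le> 3"
  shows "positive_graph E"
  unfolding positive_graph_def
proof (intro allI impI)
  fix ls :: "'a set list"
  assume "distinct ls \<and> set ls = E"
  then have ls: "distinct ls" and E: "E = set ls" by auto
  let ?q = "length ls" and ?A = "shifted_line_mat ls"
  have card2: "\<And>l. l \<in> set ls \<Longrightarrow> card l = 2"
    using assms(1) by (auto simp: tree_graph_def simple_graph_def E)
  have val: "\<And>l. l \<in> set ls \<Longrightarrow> edge_val (set ls) l \<le> 3"
    using assms(3) by (simp add: E)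
  note A = shifted_line_mat_carrier[of ls]
  have "det ?A \<noteq> 0"
    using shifted_line_mat_kernel_trivial[OF ls card2 val] det_0_iff_vec_prod_zero_field[OF A]
    by blast
  then have "?A \<in> Units (ring_mat TYPE(real) ?q ())"
    by (rule det_non_zero_imp_unit[OF A])
  then obtain B where B: "mat_inverse ?A = Some B"
    using mat_inverse(1)[OF A] by fastforce
  have inverse: "?A * B = 1\<^sub>m ?q" and carrier_B: "B \<in> carrier_mat ?q ?q"
    using mat_inverse(2)[OF A B] by auto
  let ?ones = "vec ?q (\<lambda>_. 1 :: real)"
  have x: "B *\<^sub>v ?ones \<in> carrier_vec ?q"
    using carrier_B by simp
  have "?A *\<^sub>v (B *\<^sub>v ?ones) = (?A * B) *\<^sub>v ?ones"
    using assoc_mult_mat_vec[OF A carrier_B, of ?ones] by simp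
  also have "\<dots> = ?ones" by (simp add: inverse)
  finally have solves: "?A *\<^sub>v (B *\<^sub>v ?ones) = ?ones" .
  have "0 < (B *\<^sub>v ?ones) $ i" if "i < ?q" for i
    using shifted_line_mat_nonpositive_coordinate[OF ls card2 val x solves _ that]
    by fastforce
  with B show "\<exists>B. mat_inverse (3 \<cdot>\<^sub>m 1\<^sub>m ?q + adjacency_mat (line_graph_edges E) ls) = Some B \<and>
      (\<forall>i<?q. 0 < (B *\<^sub>v ?ones) $ i)"
    unfolding E by blast
qed

end
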